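(* Let $F_0$ and $F_a$, the anomaly-score CDFs of the nominal and alien distributions, be continuous. Let $S_0$ and $S_m$ be nominal and mixture datasets containing $n$ i.i.d. samples from the nominal data distribution $D_0$ and the mixture data distribution $D_m$ respectively, where $D_m$ has alien mixture probability $\alpha$. For any $\epsilon\in(0,1-q)$ and $\delta\in(0,1)$, if $$n>\frac12\,\ln\!\left(\frac{2}{1-\sqrt{1-\delta}}\right)\left(\frac1\epsilon\right)^2\left(\frac{2-\alpha}{\alpha}\right)^2,$$ then with probability at least $1-\delta$, the threshold-selection algorithm described in the context, run with inputs $q$ and $\alpha$, will return a threshold $\hat\tau_q$ that achieves an alien detection rate of at least $1-\eta$, where $\eta=q+\epsilon$.
   Context: Setting (open category detection): there are an unknown nominal data distribution $D_0$, an unknown alien data distribution $D_a$, and a mixture distribution $D_m$ that generates a point from $D_a$ with probability $\alpha\in(0,1]$ and from $D_0$ with probability $1-\alpha$. A fixed anomaly detector assigns a real-valued anomaly score to each data point (higher means more anomalous). $F_0,F_a,F_m$ denote the CDFs of the anomaly score under $D_0,D_a,D_m$, so $F_m=(1-\alpha)F_0+\alpha F_a$. The number $q\in(0,1)$ is an input to the algorithm (a target quantile level of $F_a$). The probability $1-\delta$ is over the random draws of $S_0$ and $S_m$. Threshold-selection algorithm (inputs $q$, $\alpha$, $S_0$, $S_m$): compute the anomaly scores $x_1,\dots,x_n$ of the points of $S_0$ and $y_1,\dots,y_n$ of the points of $S_m$; compute the empirical CDFs $\hat F_0(x)=\frac1n\#\{i:x_i\le x\}$ and $\hat F_m(x)=\frac1n\#\{i:y_i\le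 x\}$; set $$\hat F_a(x)=\frac{\hat F_m(x)-(1-\alpha)\hat F_0(x)}{\alpha};$$ output $$\hat\tau_q=\max\{u\in S:\hat F_a(u)\le q\},\qquad S=\{x_1,\dots,x_n,y_1,\dots,y_n\}.$$ A point is labeled "alien" if its score is greater than the threshold. The alien detection rate of a threshold $\tau$ is the fraction of alien points (points drawn from $D_a$) labeled alien, i.e. $1-F_a(\tau)$.
   Formalization: When no score u in S satisfies F̂_a(u) ≤ q, the maximum defining the threshold is undefined (possible e.g. for α=1, q<1/n); the formal statement then sets the threshold to −∞, so every point is labeled alien. *)

theory Defs
  imports "HOL-Probability.Probability"
begin

definition mixture :: "real \<Rightarrow> 'x measure \<Rightarrow> 'x measure \<Rightarrow> 'x measure" where
  "mixture \<alpha> D\<^sub>0 D\<^sub>a = measure_pmf (bernoulli_pmf \<alpha>) \<bind> (\<lambda>alien. if alien then D\<^sub>a else D\<^sub>0)"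

definition score_cdf :: "('x \<Rightarrow> real) \<Rightarrow> 'x measure \<Rightarrow> real \<Rightarrow> real" where
  "score_cdf score D = cdf (distr D borel score)"

text \<open>Datasets and score lists of size \<open>n\<close> are families indexed by \<open>{..<n}\<close>, so repeated values
  are counted with multiplicity.\<close>

definition ecdf :: "nat \<Rightarrow> (nat \<Rightarrow> real) \<Rightarrow> real \<Rightarrow> real" where
  "ecdf n x t = real (card {i. i < n \<and> x i \<le> t}) / real n"

definition ecdf_alien :: "real \<Rightarrow> nat \<Rightarrow> (nat \<Rightarrow> real) \<Rightarrow> (nat \<Rightarrow> real) \<Rightarrow> real \<Rightarrow> real" where
  "ecdf_alien \<alpha> n x y t = (ecdf n y t - (1 - \<alpha>) * ecdf n x t) / \<alpha>"

definition admissible :: "real \<Rightarrow> real \<Rightarrow> nat \<Rightarrow> (nat \<Rightarrow> real) \<Rightarrow> (nat \<Rightarrow> real) \<Rightarrow> real set" where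
  "admissible q \<alpha> n x y = {u \<in> x ` {..<n} \<union> y ` {..<n}. ecdf_alien \<alpha> n x y u \<le> q}"

text \<open>No score need be admissible (e.g. \<open>\<alpha> = 1\<close>, \<open>q < 1 / n\<close>, and all nominal scores above all
  mixture scores). The maximum of the empty set is read as \<open>-\<infinity>\<close>: every point is then labeled
  alien. This is why thresholds are extended reals.\<close>

definition select_threshold ::
  "('x \<Rightarrow> real) \<Rightarrow> real \<Rightarrow> real \<Rightarrow> nat \<Rightarrow> (nat \<Rightarrow> 'x) \<Rightarrow> (nat \<Rightarrow> 'x) \<Rightarrow> ereal" where
  "select_threshold score q \<alpha> n S\<^sub>0 S\<^sub>m =
     (let U = admissible q \<alpha> n (\<lambda>i. score (S\<^sub>0 i)) (\<lambda>i. score (S\<^sub>m i))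
      in if U = {} then -\<infinity> else ereal (Max U))"

definition alien_detection_rate :: "('x \<Rightarrow> real) \<Rightarrow> 'x measure \<Rightarrow> ereal \<Rightarrow> real" where
  "alien_detection_rate score D\<^sub>a \<tau> = measure D\<^sub>a {z \<in> space D\<^sub>a. ereal (score z) > \<tau>}"

lemma alien_detection_rate_real:
  assumes "prob_space D\<^sub>a" and [measurable]: "score \<in> borel_measurable D\<^sub>a"
  shows "alien_detection_rate score D\<^sub>a (ereal t) = 1 - score_cdf score D\<^sub>a t"
proof -
  interpret prob_space D\<^sub>a by fact
  have "{z \<in> space D\<^sub>a. score z > t} = space D\<^sub>a - (score -` {..t} \<inter> space D\<^sub>a)"
    by auto
  then show ?thesis
    unfolding alien_detection_rate_def score_cdf_def cdf_def
    by (simp add: measure_distr) (rule prob_compl, measurable)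
qed

lemma measure_mixture:
  assumes "prob_space D\<^sub>0" "sets D\<^sub>0 = sets N" "prob_space D\<^sub>a" "sets D\<^sub>a = sets N"
    and "0 \<le> \<alpha>" "\<alpha> \<le> 1" and A: "A \<in> sets N"
  shows "measure (mixture \<alpha> D\<^sub>0 D\<^sub>a) A = (1 - \<alpha>) * measure D\<^sub>0 A + \<alpha> * measure D\<^sub>a A"
proof -
  have "D\<^sub>0 \<in> space (subprob_algebra N)" "D\<^sub>a \<in> space (subprob_algebra N)"
    using assms by (auto simp: space_subprob_algebra prob_space_imp_subprob_space)
  then have "(\<lambda>alien. if alien then D\<^sub>a else D\<^sub>0) \<in> measure_pmf (bernoulli_pmf \<alpha>) \<rightarrow>\<^sub>M subprob_algebra N"
    by (auto simp: measurable_def)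
  from measure_pmf.measure_bind[OF this A] show ?thesis
    unfolding mixture_def using assms(5,6) by simp
qed

lemma score_cdf_mixture:
  assumes "prob_space D\<^sub>0" "sets D\<^sub>0 = sets N" "prob_space D\<^sub>a" "sets D\<^sub>a = sets N"
    and "0 \<le> \<alpha>" "\<alpha> \<le> 1" and score: "score \<in> borel_measurable N"
  shows "score_cdf score (mixture \<alpha> D\<^sub>0 D\<^sub>a) t
    = (1 - \<alpha>) * score_cdf score D\<^sub>0 t + \<alpha> * score_cdf score D\<^sub>a t"
proof -
  have sm: "sets (mixture \<alpha> D\<^sub>0 D\<^sub>a) = sets N"
    unfolding mixture_def by (rule sets_bind) (auto simp: assms)
  have m: "score \<in> borel_measurable D" "space D = space N" if "sets D = sets N" for D
    using score that measurable_cong_sets[OF that refl, of borel] sets_eq_imp_space_eq[OF that] by auto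
  have "score -` {..t} \<inter> space N \<in> sets N"
    using score by measurable
  from measure_mixture[OF assms(1-6) this] show ?thesis
    unfolding score_cdf_def cdf_def
    by (simp add: measure_distr m[OF sm] m[OF assms(2)] m[OF assms(4)])
qed

end

theory Submission
  imports Defs
begin

text \<open>
  If the returned threshold has \<open>F\<^sub>a\<close>-value above \<open>q + \<epsilon>\<close>, then at some sample point either \<open>F\<^sub>m\<close>
  exceeds its empirical version, or the empirical version of \<open>F\<^sub>0\<close> exceeds \<open>F\<^sub>0\<close>, by more than
  \<open>\<lambda> = \<epsilon> \<alpha> / (2 - \<alpha>)\<close>. Each of these has probability at most \<open>exp (- 2 n \<lambda>\<^sup>2)\<close> by the one-sided
  Dvoretzky-Kiefer-Wolfowitz inequality with Massart's constant, and the hypothesis on \<open>n\<close> gives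
  \<open>2 exp (- 2 n \<lambda>\<^sup>2) < 1 - sqrt (1 - \<delta>) \<le> \<delta>\<close>.

  The one-sided inequality comes from a single change of measure: replace every observation,
  independently with probability \<open>1 - b\<close>, by \<open>+\<infinity>\<close>. If \<open>k\<close> of \<open>n\<close> observations are at most \<open>t\<close> and
  \<open>F t = s\<close>, the likelihood ratio of the observations up to \<open>t\<close> is
  \<open>b\<^sup>k ((1 - b s) / (1 - s))\<^bsup>n - k\<^esup>\<close>. At the first \<open>t\<close> where \<open>k / n < s - \<lambda>\<close>
  it is at least \<open>exp (2 n \<lambda>\<^sup>2)\<close>, uniformly in \<open>s\<close>, provided that \<open>b\<close> is chosen to be optimal for the
  value of \<open>s\<close> at which the relative entropy of Bernoulli \<open>s - \<lambda>\<close> from Bernoulli \<open>s\<close> is stationary.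
\<close>

section \<open>The tilting parameter\<close>

text \<open>The difference of the two sides vanishes at 0 and has derivative 2 y^2 / (1 - y^2). The
  bound is applied at \<open>2 * l\<close>, for a sign in the search for a stationary point, and at
  \<open>l\<^sup>2\<close>, for the left end of the tilting inequality.\<close>

lemma ln_ratio_ge:
  fixes x :: real assumes "0 \<le> x" "x < 1"
  shows "2 * x \<le> ln ((1 + x) / (1 - x))"
proof -
  let ?f = "\<lambda>x::real. ln (1 + x) - ln (1 - x) - 2 * x"
  have "?f 0 \<le> ?f x"
  proof (rule DERIV_nonneg_imp_nondecreasing[OF assms(1)])
    fix y assume y: "0 \<le> y" "y \<le> x"
    then have "y < 1" using assms by simp
    have "y * y < 1" using y assms by (smt (verit) mult_le_one mult_less_cancel_left1)
    have "(?f has_real_derivative (1 / (1 + y) + 1 / (1 - y) - 2)) (at y)"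
      by (rule derivative_eq_intros refl | use y \<open>y < 1\<close> in simp)+
    moreover have "1 / (1 + y) + 1 / (1 - y) - 2 = 2 * y * y / ((1 + y) * (1 - y))"
      using y \<open>y < 1\<close> by (simp add: divide_simps) (simp add: algebra_simps)
    ultimately show "\<exists>d. (?f has_real_derivative d) (at y) \<and> 0 \<le> d"
      using y \<open>y < 1\<close> by (intro exI[of _ "2 * y * y / ((1 + y) * (1 - y))"]) auto
  qed
  then show ?thesis using assms by (simp add: ln_div)
qed

text \<open>The difference of the two sides vanishes at 1 and its derivative is the square of 1 -
  1/y. It fixes the sign of the stationarity expression at (1 + l)/2.\<close>

lemma two_ln_le_diff_inverse:
  fixes w :: real assumes "1 \<le> w"
  shows "2 * ln w \<le> w - 1 / w"
proof -
  let ?f = "\<lambda>w::real. w - 1 / w - 2 * ln w"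
  have "?f 1 \<le> ?f w"
  proof (rule DERIV_nonneg_imp_nondecreasing[OF assms])
    fix y assume y: "1 \<le> y" "y \<le> w"
    have "(?f has_real_derivative (1 + 1 / (y * y) - 2 / y)) (at y)"
      by (rule derivative_eq_intros refl | use y in simp)+
    moreover have "1 + 1 / (y * y) - 2 / y = (1 - 1 / y)\<^sup>2"
      using y by (simp add: field_simps power2_eq_square)
    ultimately show "\<exists>d. (?f has_real_derivative d) (at y) \<and> 0 \<le> d"
      by (metis zero_le_power2)
  qed
  then show ?thesis by simp
qed

text \<open>Pinsker's inequality for Bernoulli laws. The relative entropy minus 2 (q - p)^2 vanishes
  at q = p and has derivative (q - p) (1/(q (1 - q)) - 4) in q, nonnegative because q (1 - q) \<le>
  1/4.\<close>

lemma binary_pinsker: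
  fixes p q :: real assumes "0 < p" "p \<le> q" "q < 1"
  shows "2 * (q - p)\<^sup>2 \<le> p * ln (p / q) + (1 - p) * ln ((1 - p) / (1 - q))"
proof -
  let ?f = "\<lambda>q. p * (ln p - ln q) + (1 - p) * (ln (1 - p) - ln (1 - q)) - 2 * (q - p)\<^sup>2"
  have "?f p \<le> ?f q"
  proof (rule DERIV_nonneg_imp_nondecreasing[OF assms(2)])
    fix y assume y: "p \<le> y" "y \<le> q"
    then have y': "0 < y" "y < 1" using assms by auto
    have d: "(?f has_real_derivative (- p / y + (1 - p) / (1 - y) - 4 * (y - p))) (at y)"
      by (rule derivative_eq_intros refl | use y' in simp)+
    have "- p / y + (1 - p) / (1 - y) = (y - p) * (1 / (y * (1 - y)))"
      using y' by (simp add: field_simps)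
    then have e: "- p / y + (1 - p) / (1 - y) - 4 * (y - p) = (y - p) * (1 / (y * (1 - y)) - 4)"
      by (simp only: right_diff_distrib[of "y - p"] mult.commute[of 4 "y - p"])
    have "4 \<le> 1 / (y * (1 - y))"
    proof -
      have "0 \<le> (1 - 2 * y)\<^sup>2" by simp
      then have "4 * (y * (1 - y)) \<le> 1" by (simp add: power2_eq_square algebra_simps)
      moreover have "0 < y * (1 - y)" using y' by simp
      ultimately show ?thesis by (simp add: le_divide_eq)
    qed
    then have "0 \<le> (y - p) * (1 / (y * (1 - y)) - 4)"
      using y by (intro mult_nonneg_nonneg) auto
    with d show "\<exists>d. (?f has_real_derivative d) (at y) \<and> 0 \<le> d"
      unfolding e by blast
  qed
  then have "0 \<le> ?f q" by simp
  moreover have "ln (p / q) = ln p - ln q" "ln ((1 - p) / (1 - q)) = ln (1 - p) - ln (1 - q)"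
    using assms by (simp_all add: ln_div)
  ultimately show ?thesis by (simp only: diff_ge_0_iff_ge)
qed

text \<open>The equation says that the derivative in \<open>s\<close> of the relative entropy of Bernoulli \<open>s - l\<close> from
  Bernoulli \<open>s\<close> vanishes.\<close>
lemma stationary_point_exists:
  fixes l :: real assumes l: "0 < l" "l < 1"
  obtains s where "l < s" "1 / 2 \<le> s" "s \<le> (1 + l) / 2"
    "ln (s - l) + ln (1 - s) - ln s - ln (1 - s + l) + l / (s * (1 - s)) = 0"
proof -
  define g where "g s = ln (s - l) + ln (1 - s) - ln s - ln (1 - s + l) + l / (s * (1 - s))" for s :: real
  \<comment> \<open>At the midpoint of l and 1 one has s - l = 1 - s, so the four logarithms combine
    and \<open>g c\<close> becomes \<open>(w - 1 / w) - 2 * ln w\<close>.\<close>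
  define c where "c = (1 + l) / 2"
  have c: "l < c" "1/2 < c" "c < 1" using l by (auto simp: c_def)
  have gc: "0 \<le> g c"
  proof -
    define w where "w = (1 + l) / (1 - l)"
    have w: "1 \<le> w" using l by (simp add: w_def)
    have "g c = (w - 1 / w) - 2 * ln w"
    proof -
      have e: "c - l = (1 - l) / 2" "1 - c = (1 - l) / 2" "(1 - l) / 2 + l = (1 + l) / 2"
        by (simp_all add: c_def field_simps)
      have "l / (c * (1 - c)) = w - 1 / w"
        unfolding e unfolding c_def w_def using l by (simp add: divide_simps) (simp add: algebra_simps)
      moreover have "ln (c - l) + ln (1 - c) - ln c - ln (1 - c + l) = - 2 * ln w"
        unfolding e unfolding c_def w_def using l by (simp add: ln_div)
      ultimately show ?thesis by (simp add: g_def)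
    qed
    with two_ln_le_diff_inverse[OF w] show ?thesis by simp
  qed
  \<comment> \<open>An end with \<open>g a \<le> 0\<close>: the point 1/2 serves if
    \<open>l < 1/2\<close>. Otherwise ln (s - l) drives \<open>g\<close> to minus infinity as s
    decreases to l.\<close>
  have "\<exists>a. l < a \<and> 1/2 \<le> a \<and> a \<le> c \<and> g a \<le> 0"
  proof (cases "l < 1/2")
    case True
    have "g (1/2) = ln (1/2 - l) - ln (1/2 + l) + 4 * l"
      unfolding g_def by simp
    also have "\<dots> = 2 * (2 * l) - ln ((1 + 2 * l) / (1 - 2 * l))"
    proof -
      have "ln ((1 + 2 * l) / (1 - 2 * l)) = ln ((1/2 + l) / (1/2 - l))"
        using True l by (intro arg_cong[of _ _ ln]) (simp add: field_simps)
      also have "\<dots> = ln (1/2 + l) - ln (1/2 - l)" using True l by (simp add: ln_div)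
      finally show ?thesis by simp
    qed
    also have "\<dots> \<le> 0" using ln_ratio_ge[of "2 * l"] True l by simp
    finally show ?thesis using True c by (intro exI[of _ "1/2"]) auto
  next
    case False
    have "filterlim (\<lambda>s. s - l) (at_right 0) (at_right l)"
      unfolding filterlim_at by (auto simp: eventually_at_filter intro!: tendsto_eq_intros)
    then have lim1: "LIM s (at_right l). ln (s - l) :> at_bot"
      using filterlim_compose[OF ln_at_0] by blast
    have lim2: "((\<lambda>s. ln (1 - s) - ln s - ln (1 - s + l) + l / (s * (1 - s))) \<longlongrightarrow>
       ln (1 - l) - ln l - ln (1 - l + l) + l / (l * (1 - l))) (at_right l)"
      by (rule tendsto_intros | use l in simp)+
    have "g = (\<lambda>s. (ln (1 - s) - ln s - ln (1 - s + l) + l / (s * (1 - s))) + ln (s - l))"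
      by (simp add: g_def fun_eq_iff)
    then have "LIM s (at_right l). g s :> at_bot"
      using lim1 by (simp only: filterlim_tendsto_add_at_bot_iff[OF lim2])
    then have "eventually (\<lambda>s. g s \<le> 0) (at_right l)"
      by (simp add: filterlim_at_bot)
    moreover have "eventually (\<lambda>s. s \<in> {l<..<c}) (at_right l)"
      using c by (intro eventually_at_right_real)
    ultimately have "eventually (\<lambda>s. g s \<le> 0 \<and> s \<in> {l<..<c}) (at_right l)"
      by (rule eventually_conj)
    then obtain a where "g a \<le> 0" "a \<in> {l<..<c}"
      using eventually_happens'[OF trivial_limit_at_right_real] by blast
    then show ?thesis using False by (intro exI[of _ a]) auto
  qed
  then obtain a where a: "l < a" "1/2 \<le> a" "a \<le> c" "g a \<le> 0" by blast
  have "continuous_on {a..c} g"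
    unfolding g_def using a c l by (auto intro!: continuous_intros)
  then obtain s where "a \<le> s" "s \<le> c" "g s = 0"
    using IVT'[of g a 0 c] a gc by auto
  with a show thesis by (intro that[of s]) (auto simp: g_def c_def)
qed


lemma concave_ge_min_endpoints:
  fixes f :: "real \<Rightarrow> real"
  assumes "concave_on {a..b} f" "a \<le> x" "x \<le> b" "m \<le> f a" "m \<le> f b"
  shows "m \<le> f x"
proof -
  have "x \<in> closed_segment a b" using assms by (simp add: closed_segment_eq_real_ivl)
  then obtain u where u: "0 \<le> u" "u \<le> 1" "x = (1 - u) * a + u * b"
    by (auto simp: closed_segment_def)
  have "m = (1 - u) * m + u * m" by (simp add: algebra_simps)
  also have "\<dots> \<le> (1 - u) * f a + u * f b"
    using u assms by (intro add_mono mult_left_mono) auto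
  also have "\<dots> \<le> f x"
    using concave_onD[OF assms(1) u(1,2), of a b] assms u by simp
  finally show ?thesis .
qed

text \<open>The right side is the log likelihood ratio per observation when a fraction s - l of the
  sample lies below a point with CDF value s. A single b has to work for all s. With b optimal at
  the stationary point r, the value at r is the relative entropy, which
  \<open>binary_pinsker\<close> bounds, and its derivative in s vanishes at r.\<close>

lemma tilt_exists:
  fixes l :: real assumes l: "0 < l" "l < 1"
  obtains b where "0 < b" "b < 1"
    "\<And>s. l \<le> s \<Longrightarrow> s < 1 \<Longrightarrow>
      2 * l\<^sup>2 \<le> (s - l) * ln b + (1 - s + l) * (ln (1 - b * s) - ln (1 - s))"
proof -
  from stationary_point_exists[OF l] obtain r where r: "l < r" "1 / 2 \<le> r" "r \<le> (1 + l) / 2"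
    and stat: "ln (r - l) + ln (1 - r) - ln r - ln (1 - r + l) + l / (r * (1 - r)) = 0" .
  have r': "0 < r" "r < 1" using r l by auto
  \<comment> \<open>For fixed s, the expression to be bounded is maximal over b at (s - l)/s, where
    it equals the relative entropy of Bernoulli s - l from Bernoulli s. Here s = r is taken.\<close>
  define b where "b = (r - l) / r"
  have b: "0 < b" "b < 1" using r r' l by (auto simp: b_def)
  have br: "1 - b * r = 1 - r + l" "1 - b = l / r" "ln b = ln (r - l) - ln r"
    using r' r by (auto simp: b_def field_simps ln_div)
  define f where "f s = (s - l) * ln b + (1 - s + l) * (ln (1 - b * s) - ln (1 - s))" for s
  define f' where "f' s = ln b + ((-1) * (ln (1 - b * s) - ln (1 - s))
      + (1 - b) / ((1 - s) * (1 - b * s)) * (1 - s + l))" for s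
  \<comment> \<open>The numerator left when the terms of the second derivative are put over the
    square of (1 - s) (1 - b s) and 1 - b is taken out.\<close>
  define N where "N s = l * (1 - b * s) - (1 - s) * (1 - b - l * b)" for s
  define f'' where "f'' s = (1 - b) / ((1 - s) * (1 - b * s))\<^sup>2 * N s" for s
  have bs: "0 < 1 - b * s" if "s < 1" "0 \<le> s" for s
  proof -
    have "b * s \<le> 1 * s" using b that by (intro mult_right_mono) auto
    then show ?thesis using that by simp
  qed
  have f': "(f has_real_derivative f' s) (at s)" if s: "0 \<le> s" "s < 1" for s
  proof -
    have "(f has_real_derivative ln b + ((-1) * (ln (1 - b * s) - ln (1 - s))
        + (- b / (1 - b * s) + 1 / (1 - s)) * (1 - s + l))) (at s)"
      unfolding f_def by (rule derivative_eq_intros refl | use s bs[OF s(2,1)] in simp)+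
    moreover have "- b / (1 - b * s) + 1 / (1 - s) = (1 - b) / ((1 - s) * (1 - b * s))"
      using s bs[OF s(2,1)] by (simp add: divide_simps) (simp add: algebra_simps)
    ultimately show ?thesis unfolding f'_def by (simp only:)
  qed
  have f'': "(f' has_real_derivative f'' s) (at s)" if s: "0 \<le> s" "s < 1" for s
  proof -
    define A B where "A = 1 - s" and "B = 1 - b * s"
    have AB: "0 < A" "0 < B" using s bs[OF s(2,1)] by (auto simp: A_def B_def)
    have "(f' has_real_derivative (-1) * (- b / B + 1 / A) + ((-1) * ((1 - b) / (A * B))
       + (- ((1 - b) * (- B - b * A)) / (A * B)\<^sup>2) * (A + l))) (at s)"
      unfolding f'_def A_def B_def
      by (rule derivative_eq_intros refl | use AB in \<open>simp add: A_def B_def power2_eq_square\<close>)+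
    moreover have "(-1) * (- b / B + 1 / A) + ((-1) * ((1 - b) / (A * B))
       + (- ((1 - b) * (- B - b * A)) / (A * B)\<^sup>2) * (A + l)) = f'' s"
    proof -
      have e: "B - b * A = 1 - b" by (simp add: A_def B_def algebra_simps)
      have "(-1) * (- b / B + 1 / A) = - (B - b * A) / (A * B)"
        using AB by (simp add: field_simps)
      also have "\<dots> = - (1 - b) * (A * B) / (A * B)\<^sup>2"
        unfolding e using AB by (simp add: power2_eq_square)
      finally have 1: "(-1) * (- b / B + 1 / A) = - (1 - b) * (A * B) / (A * B)\<^sup>2" .
      have 2: "(-1) * ((1 - b) / (A * B)) = - (1 - b) * (A * B) / (A * B)\<^sup>2"
        using AB by (simp add: power2_eq_square)
      have "- (1 - b) * (A * B) + (- (1 - b) * (A * B) - ((1 - b) * (- B - b * A)) * (A + l))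
        = (1 - b) * N s"
        unfolding N_def A_def B_def by algebra
      then show ?thesis
        unfolding 1 2 f''_def A_def[symmetric] B_def[symmetric]
        by (simp add: add_divide_distrib[symmetric] diff_divide_distrib[symmetric])
    qed
    ultimately show ?thesis by simp
  qed
  \<comment> \<open>\<open>f''\<close> has the sign of the affine \<open>N\<close>, so \<open>f\<close> is first concave and then convex. On the convex
    part \<open>f\<close> is minimal at \<open>r\<close>, and on the concave part it is minimal at an end point.\<close>
  have N_affine: "N s = N t + (s - t) * (1 - b - 2 * l * b)" for s t
    by (simp add: N_def algebra_simps)
  \<comment> \<open>The point r lies in the convex region; this is where
    \<open>1 / 2 \<le> r\<close> enters.\<close>
  have N_r: "0 \<le> N r"
  proof -
    have "N r = l * (1 - r + l) * (1 - (1 - r) / r)"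
      unfolding N_def br(1) using r' by (simp add: b_def field_simps)
    moreover have "(1 - r) / r \<le> 1" using r r' by simp
    ultimately show ?thesis using l r' by simp
  qed
  have N_1: "0 < N 1" using b l by (simp add: N_def)
  have f'_r: "f' r = 0"
  proof -
    have "(1 - b) / ((1 - r) * (1 - b * r)) * (1 - r + l) = l / (r * (1 - r))"
      unfolding br(1,2) using r' l by simp
    then show ?thesis using stat by (simp add: f'_def br(1,3))
  qed
  have f_r: "2 * l\<^sup>2 \<le> f r"
    using binary_pinsker[of "r - l" r] r r' l
    by (simp add: f_def br ln_div algebra_simps)
  \<comment> \<open>At s = l only the logarithm of (1 - b l)/(1 - l) remains. The bound
    \<open>r \<le> (1 + l) / 2\<close> makes this ratio at least (1 + l^2)/(1 - l^2), and
    \<open>ln_ratio_ge\<close> applies at \<open>l\<^sup>2\<close>.\<close>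
  have f_l: "2 * l\<^sup>2 \<le> f l"
  proof -
    have l2: "l\<^sup>2 < 1" using l by (simp add: power_less_one_iff)
    have "(1 + l\<^sup>2) / (1 - l\<^sup>2) \<le> (1 - b * l) / (1 - l)"
    proof -
      have "1 - b * l = 1 - l + l\<^sup>2 / r"
        using r' by (simp add: b_def field_simps power2_eq_square)
      moreover have "l\<^sup>2 / ((1 + l) / 2) \<le> l\<^sup>2 / r"
        using r r' l by (intro divide_left_mono) auto
      moreover have "(1 + l\<^sup>2) / (1 - l\<^sup>2) = (1 - l + l\<^sup>2 / ((1 + l) / 2)) / (1 - l)"
      proof -
        have e: "1 - l\<^sup>2 = (1 + l) * (1 - l)" by (simp add: power2_eq_square algebra_simps)
        have "1 - l + l\<^sup>2 / ((1 + l) / 2) = (1 + l\<^sup>2) / (1 + l)"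
          using l by (simp add: field_simps power2_eq_square)
        then show ?thesis unfolding e by simp
      qed
      ultimately show ?thesis using l by (simp add: divide_right_mono)
    qed
    moreover have "0 < (1 + l\<^sup>2) / (1 - l\<^sup>2)"
      using l2 by (intro divide_pos_pos add_pos_nonneg) auto
    ultimately have "ln ((1 + l\<^sup>2) / (1 - l\<^sup>2)) \<le> ln ((1 - b * l) / (1 - l))"
      by (intro ln_mono) auto
    moreover have "2 * l\<^sup>2 \<le> ln ((1 + l\<^sup>2) / (1 - l\<^sup>2))"
      using l2 by (intro ln_ratio_ge) auto
    moreover have "ln ((1 - b * l) / (1 - l)) = f l"
      using l bs[of l] by (simp add: f_def ln_div)
    ultimately show ?thesis by simp
  qed
  have f_convex: "2 * l\<^sup>2 \<le> f s" if s: "l \<le> s" "s < 1" and N: "0 \<le> N s" for s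
  proof -
    \<comment> \<open>Between s and 1 the affine \<open>N\<close> interpolates the nonnegative
      values \<open>N s\<close> and \<open>N 1\<close>.\<close>
    have N': "0 \<le> N t" if "s \<le> t" "t < 1 \<or> t = r" for t
    proof -
      have t: "t \<le> 1" using that r' by auto
      have "(1 - s) * N t = (1 - t) * N s + (t - s) * N 1"
        by (simp add: N_def algebra_simps)
      then have "0 \<le> (1 - s) * N t" using t that s N N_1 by simp
      then show ?thesis using s by (simp add: zero_le_mult_iff)
    qed
    have f'_mono: "f' t \<le> f' u" if "s \<le> t \<or> r \<le> t" "t \<le> u" "u < 1" "l \<le> t" for t u
    proof (rule DERIV_nonneg_imp_nondecreasing[OF that(2)])
      fix y assume y: "t \<le> y" "y \<le> u"
      have "0 \<le> N y"
      proof (cases "s \<le> y")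
        case True then show ?thesis using N' y that by auto
      next
        case False
        then have "r \<le> y" using that y by auto
        have "(1 - r) * N y = (1 - y) * N r + (y - r) * N 1"
          by (simp add: N_def algebra_simps)
        then have "0 \<le> (1 - r) * N y" using \<open>r \<le> y\<close> y that N_r N_1 by simp
        then show ?thesis using r' by (simp add: zero_le_mult_iff)
      qed
      then have "0 \<le> f'' y" using b by (simp add: f''_def)
      then show "\<exists>d. (f' has_real_derivative d) (at y) \<and> 0 \<le> d"
        using f''[of y] y that l by auto
    qed
    have "f r \<le> f s"
    proof (cases "s \<le> r")
      case True
      show ?thesis
      proof (rule DERIV_nonpos_imp_nonincreasing[OF True])
        fix y assume y: "s \<le> y" "y \<le> r"
        have "f' y \<le> 0" using f'_mono[of y r] y s r' f'_r by simp
        then show "\<exists>d. (f has_real_derivative d) (at y) \<and> d \<le> 0"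
          using f'[of y] y s l r' by auto
      qed
    next
      case False
      then have "r \<le> s" by simp
      then show ?thesis
      proof (rule DERIV_nonneg_imp_nondecreasing)
        fix y assume y: "r \<le> y" "y \<le> s"
        have "0 \<le> f' y" using f'_mono[of r y] y s r f'_r by simp
        then show "\<exists>d. (f has_real_derivative d) (at y) \<and> 0 \<le> d"
          using f'[of y] y s r' by auto
      qed
    qed
    with f_r show ?thesis by simp
  qed
  have "2 * l\<^sup>2 \<le> f s" if s: "l \<le> s" "s < 1" for s
  proof (cases "0 \<le> N s")
    case True with f_convex s show ?thesis by blast
  next
    case False
    define k where "k = 1 - b - 2 * l * b"
    have N_k: "N x = N y + (x - y) * k" for x y using N_affine by (simp add: k_def)
    \<comment> \<open>The zero of \<open>N\<close>, where concavity turns into convexity. It lies in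
      [s, 1) because \<open>N s < 0 < N 1\<close>.\<close>
    define c where "c = s - N s / k"
    have k: "0 < k"
    proof -
      have "0 < (1 - s) * k" using N_k[of 1 s] N_1 False by linarith
      then show ?thesis using s by (simp add: zero_less_mult_iff)
    qed
    have c: "s \<le> c" "N c = 0" using k False N_k[of c s] by (auto simp: c_def field_simps)
    have "c < 1"
    proof (rule ccontr)
      assume "\<not> c < 1"
      then have "(1 - c) * k \<le> 0" using k by (simp add: mult_nonpos_nonneg)
      with N_k[of 1 c] c N_1 show False by simp
    qed
    have concave: "concave_on {l..c} f"
    proof (rule f''_le0_imp_concave)
      fix x assume x: "x \<in> {l..c}"
      then show "(f has_real_derivative f' x) (at x)" "(f' has_real_derivative f'' x) (at x)"
        using f' f'' l \<open>c < 1\<close> by auto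
      have "N x \<le> 0" using N_k[of x c] c x k by (simp add: mult_nonpos_nonneg)
      then show "f'' x \<le> 0" using b unfolding f''_def by (intro mult_nonneg_nonpos) auto
    qed simp
    have "l \<le> c" using s(1) c(1) by (rule order_trans)
    then have "2 * l\<^sup>2 \<le> f c" using \<open>c < 1\<close> c(2) by (intro f_convex) auto
    with concave s(1) c(1) f_l show ?thesis by (rule concave_ge_min_endpoints)
  qed
  then show thesis using b by (intro that[of b]) (auto simp: f_def)
qed

section \<open>First crossings on a finite grid\<close>

text \<open>Since ln b is negative and ln ((1 - b p)/(1 - p)) is nonnegative, lowering k only helps,
  so k = n (p - l) is the extreme case and there the tilting inequality with s = p applies. The form
  without division covers p = 1, where the left side is 0 because k < n.\<close>

lemma tilted_power_ge:
  fixes l b p :: real and n k :: nat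
  assumes l: "0 < l" and b: "0 < b" "b < 1"
    and tilt: "\<And>s. l \<le> s \<Longrightarrow> s < 1 \<Longrightarrow>
      2 * l\<^sup>2 \<le> (s - l) * ln b + (1 - s + l) * (ln (1 - b * s) - ln (1 - s))"
    and p: "0 \<le> p" "p \<le> 1" and k: "real k < real n * (p - l)"
  shows "exp (2 * real n * l\<^sup>2) * (1 - p) ^ (n - k) \<le> b ^ k * (1 - b * p) ^ (n - k)"
proof -
  have n0: "0 < real n"
    using k by (cases "n = 0") auto
  have "real n * (p - l) \<le> real n * 1" using p l by (intro mult_left_mono) auto
  with k have kn: "k < n" by simp
  have "b * p \<le> b * 1" using b p by (intro mult_left_mono) auto
  then have bp: "0 < 1 - b * p" using b by linarith
  show ?thesis
  proof (cases "p = 1")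
    case True
    then have "exp (2 * real n * l\<^sup>2) * (1 - p) ^ (n - k) = 0" using kn by simp
    moreover have "0 \<le> b ^ k * (1 - b * p) ^ (n - k)" using b bp by simp
    ultimately show ?thesis by linarith
  next
    case False
    then have p1: "p < 1" using p by simp
    have "0 < real n * (p - l)" using k by linarith
    then have lp: "l < p" using n0 by (simp add: zero_less_mult_iff)
    define R where "R = ln (1 - b * p) - ln (1 - p)"
    have "b * p \<le> 1 * p" using b p by (intro mult_right_mono) auto
    then have R: "0 \<le> R" using p1 by (simp add: R_def)
    have "2 * real n * l\<^sup>2 = real n * (2 * l\<^sup>2)" by simp
    also have "\<dots> \<le> real n * ((p - l) * ln b + (1 - p + l) * R)"
      unfolding R_def using lp p1 by (intro mult_left_mono tilt) auto
    also have "\<dots> = (real n * (p - l)) * ln b + (real n - real n * (p - l)) * R"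
      by (simp add: algebra_simps)
    also have "\<dots> \<le> real k * ln b + (real n - real k) * R"
      using k b R by (intro add_mono mult_right_mono mult_right_mono_neg) auto
    finally have le: "2 * real n * l\<^sup>2 \<le> real k * ln b + (real n - real k) * R" .
    have "exp (2 * real n * l\<^sup>2) * (1 - p) ^ (n - k)
        = exp (2 * real n * l\<^sup>2 + real (n - k) * ln (1 - p))"
      using p1 by (simp add: exp_add exp_of_nat_mult)
    also have "\<dots> \<le> exp (real k * ln b + real (n - k) * ln (1 - b * p))"
      using le kn by (simp add: R_def of_nat_diff right_diff_distrib)
    also have "\<dots> = b ^ k * (1 - b * p) ^ (n - k)"
      using b bp by (simp add: exp_add exp_of_nat_mult)
    finally show ?thesis .
  qed
qed

text \<open>A discrete change of measure: \<open>w\<close> is the law of one observation, each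
  \<open>f\<close> is a sample, and the product is its probability. On samples with first crossing
  at j, the tilted weight is at least exp (2 n l^2) times the original one. The first-crossing
  classes are disjoint and the tilted weights of all samples sum to 1.\<close>

lemma crossing_sum_le:
  fixes w :: "'a::linorder \<Rightarrow> real" and T :: "'a set" and I :: "'i set" and l :: real
  assumes T: "finite T" and w0: "\<And>t. t \<in> T \<Longrightarrow> 0 \<le> w t" and w1: "sum w T = 1"
    and I: "finite I" "I \<noteq> {}" and l: "0 < l" "l < 1"
  shows "(\<Sum>f | f \<in> I \<rightarrow>\<^sub>E T \<and>
      (\<exists>t\<in>T. l < sum w {s \<in> T. s \<le> t} - real (card {i \<in> I. f i \<le> t}) / real (card I)).
      \<Prod>i\<in>I. w (f i)) \<le> exp (- 2 * real (card I) * l\<^sup>2)"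
proof -
  define n where "n = card I"
  have n: "0 < n" using I by (simp add: n_def card_gt_0_iff)
  define p where "p t = sum w {s \<in> T. s \<le> t}" for t
  define c where "c f t = card {i \<in> I. f i \<le> t}" for f :: "'i \<Rightarrow> 'a" and t
  define cross where "cross f t \<longleftrightarrow> l < p t - real (c f t) / real n" for f t
  define X where "X j = {f \<in> I \<rightarrow>\<^sub>E T. cross f j \<and> (\<forall>t\<in>T. t < j \<longrightarrow> \<not> cross f t)}" for j
  define K where "K = exp (2 * real n * l\<^sup>2)"
  have T_ne: "T \<noteq> {}" using w1 by auto
  define m where "m = Max T"
  have m: "m \<in> T" "\<And>t. t \<in> T \<Longrightarrow> t \<le> m" using T T_ne by (auto simp: m_def)
  from tilt_exists[OF l] obtain b where b: "0 < b" "b < 1"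
    and tilt: "\<And>s. l \<le> s \<Longrightarrow> s < 1 \<Longrightarrow>
      2 * l\<^sup>2 \<le> (s - l) * ln b + (1 - s + l) * (ln (1 - b * s) - ln (1 - s))" by blast
  \<comment> \<open>The law of an observation kept with probability b and otherwise sent to the top
    point \<open>m\<close>, which plays the role of infinity.\<close>
  define v where "v t = b * w t + (if t = m then 1 - b else 0)" for t
  have v0: "0 \<le> v t" if "t \<in> T" for t using w0[OF that] b by (simp add: v_def)
  have v1: "sum v T = 1"
    using T m w1 by (simp add: v_def sum.distrib sum_distrib_left[symmetric])
  have p: "0 \<le> p t" "p t \<le> 1" for t
  proof -
    show "0 \<le> p t" unfolding p_def by (intro sum_nonneg) (use w0 in auto)
    have "p t \<le> sum w T" unfolding p_def using T by (intro sum_mono2) (use w0 in auto)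
    then show "p t \<le> 1" by (simp add: w1)
  qed
  have fin: "finite (I \<rightarrow>\<^sub>E T)" using I T by (simp add: finite_PiE)
  have finX: "finite (X j)" for j using fin by (simp add: X_def)

  \<comment> \<open>Likelihood ratio on one first-crossing class\<close>
  have first: "K * (\<Sum>f\<in>X j. \<Prod>i\<in>I. w (f i)) \<le> (\<Sum>f\<in>X j. \<Prod>i\<in>I. v (f i))" if j: "j \<in> T" for j
  proof (cases "j = m")
    case True
    \<comment> \<open>At the top point all n observations are counted, so the deviation is not
      positive.\<close>
    have "\<not> cross f m" if "f \<in> I \<rightarrow>\<^sub>E T" for f
    proof -
      have "{i \<in> I. f i \<le> m} = I" using that m by (auto simp: PiE_def Pi_def)
      then have "c f m = n" by (simp add: c_def n_def)
      then show ?thesis using p[of m] n l by (simp add: cross_def)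
    qed
    then have "X j = {}" by (auto simp: X_def True)
    then show ?thesis by simp
  next
    case False
    then have jm: "j < m" using m j by (simp add: less_le)
    define above where "above = {t \<in> T. j < t}"
    have split: "T = {s \<in> T. s \<le> j} \<union> above" "{s \<in> T. s \<le> j} \<inter> above = {}"
      by (auto simp: above_def)
    have fin_above: "finite above" "m \<in> above" using T m jm by (auto simp: above_def)
    have w_above: "sum w above = 1 - p j"
    proof -
      have "sum w T = p j + sum w above"
        unfolding p_def using T fin_above split(2)
        by (subst arg_cong[OF split(1), of "sum w"], intro sum.union_disjoint) auto
      then show ?thesis using w1 by simp
    qed
    \<comment> \<open>The mass 1 - b moved to \<open>m\<close> lies entirely above j, because j <
      m.\<close>
    have v_above: "sum v above = 1 - b * p j"
      using fin_above
      by (simp add: v_def sum.distrib sum_distrib_left[symmetric] w_above algebra_simps)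
    \<comment> \<open>Whether \<open>j\<close> is the first crossing depends on \<open>f\<close> only through \<open>tr f\<close>, and on the fibres of \<open>tr\<close>
      both products sum to products.\<close>
    define tr where "tr f = (\<lambda>i\<in>I. if f i \<le> j then f i else m)" for f
    define fib where "fib g = (\<lambda>i. if g i \<le> j then {g i} else above)" for g :: "'i \<Rightarrow> 'a"
    have fibre: "{f \<in> X j. tr f = g} = PiE I (fib g)" if g: "g \<in> tr ` X j" for g
    proof -
      from g obtain f0 where f0: "f0 \<in> X j" "g = tr f0" by blast
      have same: "c f t = c g t" if "tr f = g" "t \<le> j" for f t
      proof -
        have "{i \<in> I. f i \<le> t} = {i \<in> I. g i \<le> t}"
          using jm that by (auto simp: tr_def split: if_splits)
        then show ?thesis by (simp add: c_def)
      qed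
      have X_iff: "f \<in> X j" if "tr f = g" "f \<in> I \<rightarrow>\<^sub>E T" for f
        using f0 that same[OF that(1)] same[OF f0(2)[symmetric]]
        by (auto simp: X_def cross_def)
      have tr_iff: "tr f = g \<longleftrightarrow> f \<in> PiE I (fib g)" if "f \<in> I \<rightarrow>\<^sub>E T" for f
      proof
        assume "tr f = g"
        then show "f \<in> PiE I (fib g)"
          using that jm by (auto simp: fib_def tr_def above_def PiE_def Pi_def not_le split: if_splits)
      next
        assume f: "f \<in> PiE I (fib g)"
        show "tr f = g"
        proof
          fix i
          show "tr f i = g i"
          proof (cases "i \<in> I")
            case True
            then have "f i \<in> fib g i" "g i \<le> j \<or> g i = m"
              using f f0 by (auto simp: tr_def)
            then show ?thesis using True jm
              by (auto simp: fib_def tr_def above_def split: if_splits)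
          qed (simp add: f0 tr_def)
        qed
      qed
      have "g i \<in> T" if "i \<in> I" for i
        using f0 that m by (auto simp: tr_def X_def)
      then have sub: "PiE I (fib g) \<subseteq> I \<rightarrow>\<^sub>E T"
        by (intro PiE_mono) (auto simp: fib_def above_def)
      show ?thesis
      proof (intro set_eqI iffI)
        fix f assume "f \<in> {f \<in> X j. tr f = g}"
        then show "f \<in> PiE I (fib g)" using tr_iff[of f] by (simp add: X_def)
      next
        fix f assume f: "f \<in> PiE I (fib g)"
        with sub have "f \<in> I \<rightarrow>\<^sub>E T" by (rule subsetD)
        with f show "f \<in> {f \<in> X j. tr f = g}" using tr_iff[of f] X_iff[of f] by simp
      qed
    qed
    \<comment> \<open>On a fibre the coordinates with \<open>g i \<le> j\<close> are fixed, and the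
      remaining \<open>n - c g j\<close> range freely over \<open>above\<close>.\<close>
    have fibre_sum: "(\<Sum>f | f \<in> X j \<and> tr f = g. \<Prod>i\<in>I. u (f i))
        = (\<Prod>i | i \<in> I \<and> g i \<le> j. u (g i)) * sum u above ^ (n - c g j)"
      if g: "g \<in> tr ` X j" for g and u :: "'a \<Rightarrow> real"
    proof -
      have "(\<Sum>f | f \<in> X j \<and> tr f = g. \<Prod>i\<in>I. u (f i)) = (\<Prod>i\<in>I. sum u (fib g i))"
        unfolding fibre[OF g]
        using I fin_above by (subst prod_sum_PiE) (auto simp: fib_def)
      also have "\<dots> = (\<Prod>i\<in>I. if g i \<le> j then u (g i) else sum u above)"
        by (intro prod.cong) (auto simp: fib_def)
      also have "\<dots> = (\<Prod>i\<in>I \<inter> {i. g i \<le> j}. u (g i)) * (\<Prod>i\<in>I \<inter> - {i. g i \<le> j}. sum u above)"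
        using I by (intro prod.If_cases)
      also have "(\<Prod>i\<in>I \<inter> - {i. g i \<le> j}. sum u above) = sum u above ^ (n - c g j)"
      proof -
        have "I \<inter> - {i. g i \<le> j} = I - {i \<in> I. g i \<le> j}" by auto
        then have "card (I \<inter> - {i. g i \<le> j}) = n - c g j"
          using I by (simp add: card_Diff_subset n_def c_def)
        then show ?thesis by simp
      qed
      also have "I \<inter> {i. g i \<le> j} = {i \<in> I. g i \<le> j}" by auto
      finally show ?thesis .
    qed
    have ineq: "K * (\<Sum>f | f \<in> X j \<and> tr f = g. \<Prod>i\<in>I. w (f i))
        \<le> (\<Sum>f | f \<in> X j \<and> tr f = g. \<Prod>i\<in>I. v (f i))" if g: "g \<in> tr ` X j" for g
    proof -
      from g obtain f0 where f0: "f0 \<in> X j" "g = tr f0" by blast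
      have gT: "g i \<in> T" if "i \<in> I" for i
        using f0 that m by (auto simp: tr_def X_def)
      have "{i \<in> I. f0 i \<le> j} = {i \<in> I. g i \<le> j}"
        using jm f0 by (auto simp: tr_def split: if_splits)
      then have "c g j = c f0 j" by (simp add: c_def)
      then have "l < p j - real (c g j) / real n" using f0 by (simp add: X_def cross_def)
      then have k: "real (c g j) < real n * (p j - l)" using n by (simp add: field_simps)
      define W where "W = (\<Prod>i | i \<in> I \<and> g i \<le> j. w (g i))"
      have W: "0 \<le> W" unfolding W_def using w0 gT by (intro prod_nonneg) auto
      \<comment> \<open>No value at or below j equals \<open>m\<close>, so on these coordinates
        \<open>v\<close> is b times \<open>w\<close>.\<close>
      have vW: "(\<Prod>i | i \<in> I \<and> g i \<le> j. v (g i)) = b ^ c g j * W"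
      proof -
        have "(\<Prod>i | i \<in> I \<and> g i \<le> j. v (g i)) = (\<Prod>i | i \<in> I \<and> g i \<le> j. b * w (g i))"
          using jm by (intro prod.cong) (auto simp: v_def)
        then show ?thesis by (simp add: prod.distrib W_def c_def)
      qed
      have "K * (W * (1 - p j) ^ (n - c g j)) = W * (K * (1 - p j) ^ (n - c g j))"
        by simp
      also have "\<dots> \<le> W * (b ^ c g j * (1 - b * p j) ^ (n - c g j))"
        unfolding K_def using W by (intro mult_left_mono tilted_power_ge l b tilt p k)
      finally show ?thesis
        unfolding fibre_sum[OF g] w_above v_above vW W_def[symmetric] by (simp add: mult_ac)
    qed
    have "K * (\<Sum>f\<in>X j. \<Prod>i\<in>I. w (f i))
        = (\<Sum>g\<in>tr ` X j. K * (\<Sum>f | f \<in> X j \<and> tr f = g. \<Prod>i\<in>I. w (f i)))"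
      by (simp only: sum.image_gen[OF finX[of j], of _ tr] sum_distrib_left)
    also have "\<dots> \<le> (\<Sum>g\<in>tr ` X j. \<Sum>f | f \<in> X j \<and> tr f = g. \<Prod>i\<in>I. v (f i))"
      by (rule sum_mono) (rule ineq)
    also have "\<dots> = (\<Sum>f\<in>X j. \<Prod>i\<in>I. v (f i))"
      by (rule sum.image_gen[OF finX, symmetric])
    finally show ?thesis .
  qed

  \<comment> \<open>Summation over the first-crossing classes\<close>
  define Bad where "Bad = {f \<in> I \<rightarrow>\<^sub>E T. \<exists>t\<in>T. cross f t}"
  have Bad: "Bad = (\<Union>j\<in>T. X j)"
  proof
    show "Bad \<subseteq> (\<Union>j\<in>T. X j)"
    proof
      fix f assume f: "f \<in> Bad"
      define j where "j = Min {t \<in> T. cross f t}"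
      have ne: "finite {t \<in> T. cross f t}" "{t \<in> T. cross f t} \<noteq> {}"
        using T f by (auto simp: Bad_def)
      from Min_in[OF ne] have "j \<in> T" "cross f j" by (auto simp: j_def)
      moreover have "\<not> cross f t" if "t \<in> T" "t < j" for t
        using Min_le[OF ne(1), of t] that by (auto simp: j_def)
      ultimately show "f \<in> (\<Union>j\<in>T. X j)" using f by (auto simp: X_def Bad_def)
    qed
  qed (auto simp: Bad_def X_def)
  have sum_Bad: "sum h Bad = (\<Sum>j\<in>T. sum h (X j))" for h :: "_ \<Rightarrow> real"
    unfolding Bad
  proof (intro sum.UNION_disjoint T ballI finX impI)
    fix i j assume "i \<in> T" "j \<in> T" "i \<noteq> j"
    then show "X i \<inter> X j = {}" by (cases i j rule: linorder_cases) (auto simp: X_def)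
  qed
  have "K * (\<Sum>f\<in>Bad. \<Prod>i\<in>I. w (f i)) \<le> (\<Sum>f\<in>Bad. \<Prod>i\<in>I. v (f i))"
    unfolding sum_Bad sum_distrib_left[of K _ T] by (rule sum_mono) (rule first)
  also have "\<dots> \<le> (\<Sum>f\<in>I \<rightarrow>\<^sub>E T. \<Prod>i\<in>I. v (f i))"
    by (intro sum_mono2 fin) (auto simp: Bad_def intro!: prod_nonneg v0)
  also have "\<dots> = 1"
    using I T v1 by (subst prod_sum_PiE[symmetric]) auto
  finally have "(\<Sum>f\<in>Bad. \<Prod>i\<in>I. w (f i)) \<le> 1 / K"
    by (simp add: K_def le_divide_eq mult.commute)
  also have "1 / K = exp (- 2 * real (card I) * l\<^sup>2)"
    by (simp add: K_def n_def exp_minus divide_inverse)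
  finally show ?thesis by (simp add: Bad_def cross_def p_def c_def n_def)
qed

section \<open>The one-sided Dvoretzky-Kiefer-Wolfowitz inequality\<close>

text \<open>Rounding each observation up to the next grid point preserves every comparison with a
  grid point, so the deviation event depends only on the rounded sample. By independence its law is
  a product of weights on a finite set, and \<open>crossing_sum_le\<close> applies.\<close>

lemma (in prob_space) cdf_exceeds_ecdf_finite_le:
  fixes Z :: "'i \<Rightarrow> 'a \<Rightarrow> real"
  assumes I: "finite I" "I \<noteq> {}" and indep: "indep_vars (\<lambda>_. borel) Z I"
    and D: "\<And>i. i \<in> I \<Longrightarrow> distr M borel (Z i) = D"
    and G: "finite G" and l: "0 < l" "l < 1"
  shows "prob {\<omega> \<in> space M. \<exists>t\<in>G. l < cdf D t - real (card {i \<in> I. Z i \<omega> \<le> t}) / real (card I)}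
    \<le> exp (- 2 * real (card I) * l\<^sup>2)"
proof -
  have Z: "Z i \<in> borel_measurable M" if "i \<in> I" for i
    using indep that by (simp add: indep_vars_def2)
  obtain i0 where i0: "i0 \<in> I" using I by blast
  interpret D: real_distribution D
    using real_distribution_distr[OF Z[OF i0]] D[OF i0] by simp
  \<comment> \<open>The added infinity gives observations above all of \<open>G\<close> a point to
    be rounded up to.\<close>
  define T where "T = insert \<infinity> (ereal ` G)"
  have T: "finite T" "\<infinity> \<in> T" using G by (auto simp: T_def)
  define L where "L x = Min {s \<in> T. ereal x \<le> s}" for x
  have fin_L: "finite {s \<in> T. ereal x \<le> s}" "{s \<in> T. ereal x \<le> s} \<noteq> {}" for x
    using T by auto
  have L_in: "L x \<in> T" "ereal x \<le> L x" for x
    using Min_in[OF fin_L, of x] by (auto simp: L_def)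
  have L_le: "L x \<le> s \<longleftrightarrow> ereal x \<le> s" if "s \<in> T" for x s
    using Min_le[OF fin_L(1), of s x] L_in(2)[of x] that by (auto simp: L_def[symmetric])
  define B where "B s = {x. L x = s}" for s
  have B_sets: "B s \<in> sets borel" if "s \<in> T" for s
  proof -
    have "B s = {x. ereal x \<le> s} - (\<Union>u\<in>{u \<in> T. u < s}. {x. ereal x \<le> u})"
    proof (intro set_eqI iffI)
      fix x assume "x \<in> B s"
      then show "x \<in> {x. ereal x \<le> s} - (\<Union>u\<in>{u \<in> T. u < s}. {x. ereal x \<le> u})"
        using L_le[of _ x] L_in(2)[of x] by (auto simp: B_def not_le[symmetric])
    next
      fix x assume x: "x \<in> {x. ereal x \<le> s} - (\<Union>u\<in>{u \<in> T. u < s}. {x. ereal x \<le> u})"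
      then have "L x \<le> s" using L_le[OF that] by simp
      moreover have "\<not> L x < s" using x L_in[of x] by blast
      ultimately show "x \<in> B s" by (simp add: B_def)
    qed
    moreover have "{x. ereal x \<le> u} \<in> sets borel" for u by measurable
    ultimately show ?thesis
      using T by (simp only:) (intro sets.Diff sets.finite_UN; simp)
  qed
  define w where "w s = measure D (B s)" for s
  have w_le: "sum w {s \<in> T. s \<le> t} = measure D {x. ereal x \<le> t}" if t: "t \<in> T" for t
  proof -
    have "sum w {s \<in> T. s \<le> t} = measure D (\<Union>s\<in>{s \<in> T. s \<le> t}. B s)"
      unfolding w_def using T B_sets
      by (intro D.finite_measure_finite_Union[symmetric]) (auto simp: disjoint_family_on_def B_def)
    also have "(\<Union>s\<in>{s \<in> T. s \<le> t}. B s) = {x. ereal x \<le> t}"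
      using L_le[OF t] L_in by (auto simp: B_def)
    finally show ?thesis .
  qed
  have w1: "sum w T = 1"
    using w_le[OF T(2)] D.prob_space by simp
  define Bad where "Bad = {f \<in> I \<rightarrow>\<^sub>E T.
      \<exists>t\<in>T. l < sum w {s \<in> T. s \<le> t} - real (card {i \<in> I. f i \<le> t}) / real (card I)}"
  have fin_Bad: "finite Bad" using I T by (simp add: Bad_def finite_PiE)
  define E where "E f = (\<Inter>i\<in>I. Z i -` B (f i) \<inter> space M)" for f
  have Bad_T: "f i \<in> T" if "f \<in> Bad" "i \<in> I" for f i using that by (auto simp: Bad_def)
  have E_sets: "E f \<in> events" if "f \<in> Bad" for f
    unfolding E_def using I Z B_sets Bad_T[OF that]
    by (intro sets.finite_INT measurable_sets) auto
  have prob_E: "prob (E f) = (\<Prod>i\<in>I. w (f i))" if f: "f \<in> Bad" for f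
  proof -
    have "prob (E f) = (\<Prod>i\<in>I. prob (Z i -` B (f i) \<inter> space M))"
      unfolding E_def using I B_sets Bad_T[OF f] by (intro indep_varsD_finite[OF indep]) auto
    also have "\<dots> = (\<Prod>i\<in>I. w (f i))"
    proof (intro prod.cong refl)
      fix i assume i: "i \<in> I"
      show "prob (Z i -` B (f i) \<inter> space M) = w (f i)"
        unfolding w_def D[OF i, symmetric] by (rule measure_distr[symmetric, OF Z[OF i] B_sets[OF Bad_T[OF f i]]])
    qed
    finally show ?thesis .
  qed
  have event: "{\<omega> \<in> space M. \<exists>t\<in>G. l < cdf D t - real (card {i \<in> I. Z i \<omega> \<le> t}) / real (card I)}
      \<subseteq> (\<Union>f\<in>Bad. E f)"
  proof
    fix \<omega> assume "\<omega> \<in> {\<omega> \<in> space M. \<exists>t\<in>G. l < cdf D t - real (card {i \<in> I. Z i \<omega> \<le> t}) / real (card I)}"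
    then obtain t where \<omega>: "\<omega> \<in> space M" and t: "t \<in> G"
      and dev: "l < cdf D t - real (card {i \<in> I. Z i \<omega> \<le> t}) / real (card I)" by blast
    define f where "f = (\<lambda>i\<in>I. L (Z i \<omega>))"
    have tT: "ereal t \<in> T" using t by (simp add: T_def)
    have "{i \<in> I. f i \<le> ereal t} = {i \<in> I. Z i \<omega> \<le> t}"
      using L_le[OF tT] by (auto simp: f_def)
    moreover have "sum w {s \<in> T. s \<le> ereal t} = cdf D t"
      unfolding w_le[OF tT] by (simp add: cdf_def atMost_def)
    moreover have "f \<in> I \<rightarrow>\<^sub>E T" using L_in by (simp add: f_def)
    ultimately have "f \<in> Bad" using dev tT by (auto simp: Bad_def intro!: bexI[of _ "ereal t"])
    moreover have "\<omega> \<in> E f" using \<omega> I by (auto simp: E_def f_def B_def)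
    ultimately show "\<omega> \<in> (\<Union>f\<in>Bad. E f)" by blast
  qed
  have "prob {\<omega> \<in> space M. \<exists>t\<in>G. l < cdf D t - real (card {i \<in> I. Z i \<omega> \<le> t}) / real (card I)}
      \<le> prob (\<Union>f\<in>Bad. E f)"
    using event fin_Bad E_sets by (intro finite_measure_mono) auto
  also have "\<dots> \<le> (\<Sum>f\<in>Bad. prob (E f))"
    using fin_Bad E_sets by (intro finite_measure_subadditive_finite) auto
  also have "\<dots> = (\<Sum>f\<in>Bad. \<Prod>i\<in>I. w (f i))" by (intro sum.cong prob_E refl)
  also have "\<dots> \<le> exp (- 2 * real (card I) * l\<^sup>2)"
    unfolding Bad_def by (intro crossing_sum_le T w1 I l) (simp add: w_def)
  finally show ?thesis .
qed

section \<open>From finite grids to all real thresholds\<close>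

lemma ecdf_right_constant:
  obtains u where "t < u" "\<And>s. t \<le> s \<Longrightarrow> s < u \<Longrightarrow> ecdf n x s = ecdf n x t"
proof -
  define u where "u = Min (insert (t + 1) {x i | i. i < n \<and> t < x i})"
  have fin: "finite (insert (t + 1) {x i | i. i < n \<and> t < x i})" by simp
  have "t < u" unfolding u_def using fin by (subst Min_gr_iff) auto
  moreover have "ecdf n x s = ecdf n x t" if s: "t \<le> s" "s < u" for s
  proof -
    have "x i \<le> t" if "i < n" "x i \<le> s" for i
    proof (rule ccontr)
      assume "\<not> x i \<le> t"
      then have "u \<le> x i" unfolding u_def using fin that by (intro Min_le) auto
      then show False using that s by simp
    qed
    then have "{i. i < n \<and> x i \<le> s} = {i. i < n \<and> x i \<le> t}" using s by auto
    then show ?thesis by (simp add: ecdf_def)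
  qed
  ultimately show thesis using that by blast
qed

text \<open>The argument may be random because candidate thresholds are themselves sample
  scores.\<close>

lemma borel_measurable_ecdf:
  assumes "\<And>i. i < n \<Longrightarrow> Z i \<in> borel_measurable M" "g \<in> borel_measurable M"
  shows "(\<lambda>\<omega>. ecdf n (\<lambda>i. Z i \<omega>) (g \<omega>)) \<in> borel_measurable M"
proof -
  have "ecdf n (\<lambda>i. Z i \<omega>) (g \<omega>) = (\<Sum>i<n. if Z i \<omega> \<le> g \<omega> then 1 else 0) / real n" for \<omega>
    by (simp add: ecdf_def sum.If_cases Int_def lessThan_def)
  then show ?thesis using assms by simp
qed

text \<open>A deviation at t persists at rationals slightly to the right, where the empirical CDF is
  unchanged and the CDF is no smaller. The event is thus a countable union over rationals, and the
  bound for finite grids passes to the limit by continuity from below.\<close>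

lemma (in prob_space) cdf_exceeds_ecdf_le:
  fixes Z :: "nat \<Rightarrow> 'a \<Rightarrow> real"
  assumes n: "0 < n" and indep: "indep_vars (\<lambda>_. borel) Z {..<n}"
    and D: "\<And>i. i < n \<Longrightarrow> distr M borel (Z i) = D"
    and l: "0 < l" "l < 1"
  shows "{\<omega> \<in> space M. \<exists>t. l < cdf D t - ecdf n (\<lambda>i. Z i \<omega>) t} \<in> events"
    and "prob {\<omega> \<in> space M. \<exists>t. l < cdf D t - ecdf n (\<lambda>i. Z i \<omega>) t} \<le> exp (- 2 * real n * l\<^sup>2)"
proof -
  have Z: "Z i \<in> borel_measurable M" if "i < n" for i
    using indep that by (simp add: indep_vars_def2)
  interpret D: real_distribution D
    using real_distribution_distr[OF Z[OF n]] D[OF n] by simp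
  define A where "A t = {\<omega> \<in> space M. l < cdf D t - ecdf n (\<lambda>i. Z i \<omega>) t}" for t
  have A: "A t \<in> events" for t
    unfolding A_def using borel_measurable_ecdf[OF Z, where n = n and g = "\<lambda>_. t"] by measurable
  define r where "r k = real_of_rat (from_nat k)" for k
  have rational: "{\<omega> \<in> space M. \<exists>t. l < cdf D t - ecdf n (\<lambda>i. Z i \<omega>) t} = (\<Union>k. A (r k))"
  proof
    show "{\<omega> \<in> space M. \<exists>t. l < cdf D t - ecdf n (\<lambda>i. Z i \<omega>) t} \<subseteq> (\<Union>k. A (r k))"
    proof
      fix \<omega> assume "\<omega> \<in> {\<omega> \<in> space M. \<exists>t. l < cdf D t - ecdf n (\<lambda>i. Z i \<omega>) t}"
      then obtain t where t: "\<omega> \<in> space M" "l < cdf D t - ecdf n (\<lambda>i. Z i \<omega>) t" by blast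
      obtain u where u: "t < u" "\<And>s. t \<le> s \<Longrightarrow> s < u \<Longrightarrow> ecdf n (\<lambda>i. Z i \<omega>) s = ecdf n (\<lambda>i. Z i \<omega>) t"
        using ecdf_right_constant by blast
      obtain q where q: "t < real_of_rat q" "real_of_rat q < u"
        using of_rat_dense[OF u(1)] by blast
      have "cdf D t \<le> cdf D (real_of_rat q)" using q by (intro D.cdf_nondecreasing) simp
      then have "\<omega> \<in> A (r (to_nat q))" using t u(2)[of "real_of_rat q"] q by (simp add: A_def r_def)
      then show "\<omega> \<in> (\<Union>k. A (r k))" by blast
    qed
  qed (auto simp: A_def)
  then show "{\<omega> \<in> space M. \<exists>t. l < cdf D t - ecdf n (\<lambda>i. Z i \<omega>) t} \<in> events"
    using A by auto
  have "(\<lambda>k. prob (\<Union>j\<le>k. A (r j))) \<longlonglongrightarrow> prob (\<Union>k. \<Union>j\<le>k. A (r j))"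
    using A by (intro finite_Lim_measure_incseq) (auto simp: incseq_def intro: order_trans)
  moreover have "(\<Union>k. \<Union>j\<le>k. A (r j)) = (\<Union>k. A (r k))" by auto
  moreover have "prob (\<Union>j\<le>k. A (r j)) \<le> exp (- 2 * real n * l\<^sup>2)" for k
  proof -
    have "(\<Union>j\<le>k. A (r j)) = {\<omega> \<in> space M. \<exists>t\<in>r ` {..k}.
        l < cdf D t - real (card {i \<in> {..<n}. Z i \<omega> \<le> t}) / real (card {..<n})}"
      by (auto simp: A_def ecdf_def)
    then show ?thesis
      using cdf_exceeds_ecdf_finite_le[of "{..<n}" Z D "r ` {..k}" l] n indep D l
      by (simp add: lessThan_empty_iff)
  qed
  ultimately show "prob {\<omega> \<in> space M. \<exists>t. l < cdf D t - ecdf n (\<lambda>i. Z i \<omega>) t} \<le> exp (- 2 * real n * l\<^sup>2)"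
    unfolding rational by (intro LIMSEQ_le_const2) auto
qed

text \<open>The opposite deviation becomes the previous one for the negated observations. Reflection
  yields only an inclusion of events, hence the measurable cover in the conclusion.\<close>

lemma (in prob_space) ecdf_exceeds_cdf_le:
  fixes Z :: "nat \<Rightarrow> 'a \<Rightarrow> real"
  assumes n: "0 < n" and indep: "indep_vars (\<lambda>_. borel) Z {..<n}"
    and D: "\<And>i. i < n \<Longrightarrow> distr M borel (Z i) = D"
    and l: "0 < l" "l < 1"
  obtains A where "A \<in> events" "prob A \<le> exp (- 2 * real n * l\<^sup>2)"
    "{\<omega> \<in> space M. \<exists>t. l < ecdf n (\<lambda>i. Z i \<omega>) t - cdf D t} \<subseteq> A"
proof -
  have Z: "Z i \<in> borel_measurable M" if "i < n" for i
    using indep that by (simp add: indep_vars_def2)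
  interpret D: real_distribution D
    using real_distribution_distr[OF Z[OF n]] D[OF n] by simp
  define D' where "D' = distr D borel uminus"
  define Z' where "Z' = (\<lambda>i \<omega>. - Z i \<omega>)"
  have indep': "indep_vars (\<lambda>_. borel) Z' {..<n}"
    unfolding Z'_def by (rule indep_vars_compose2[OF indep]) simp
  have D': "distr M borel (Z' i) = D'" if "i < n" for i
    using Z[OF that] unfolding D'_def D[OF that, symmetric]
    by (subst distr_distr) (auto simp: comp_def Z'_def)
  \<comment> \<open>Reflecting turns \<open>\<le> t\<close> into \<open>\<ge> - t\<close>, so the threshold has to be moved slightly to the right.\<close>
  have "\<exists>s. l < cdf D' s - ecdf n (\<lambda>i. Z' i \<omega>) s"
    if t: "l < ecdf n (\<lambda>i. Z i \<omega>) t - cdf D t" for \<omega> t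
  proof -
    have "(cdf D \<longlongrightarrow> cdf D t) (at_right t)"
      using D.cdf_is_right_cont by (simp add: continuous_within)
    then have "eventually (\<lambda>u. cdf D u < ecdf n (\<lambda>i. Z i \<omega>) t - l) (at_right t)"
      using t by (intro order_tendstoD) auto
    moreover have "eventually (\<lambda>u. t < u) (at_right t)" by (simp add: eventually_at_filter)
    ultimately have "eventually (\<lambda>u. cdf D u < ecdf n (\<lambda>i. Z i \<omega>) t - l \<and> t < u) (at_right t)"
      by (rule eventually_conj)
    then obtain u where u: "cdf D u < ecdf n (\<lambda>i. Z i \<omega>) t - l" "t < u"
      using eventually_happens'[OF trivial_limit_at_right_real] by blast
    have "1 - cdf D u = measure D (space D - {..u})"
      unfolding cdf_def by (rule D.prob_compl[symmetric]) simp
    also have "\<dots> \<le> measure D {x. - x \<le> - u}"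
      by (intro D.finite_measure_mono) auto
    also have "\<dots> = cdf D' (- u)"
      unfolding cdf_def D'_def by (subst measure_distr) (auto simp: vimage_def)
    finally have 1: "1 - cdf D u \<le> cdf D' (- u)" .
    have "card {i. i < n \<and> Z' i \<omega> \<le> - u} + card {i. i < n \<and> Z i \<omega> \<le> t}
        = card ({i. i < n \<and> Z' i \<omega> \<le> - u} \<union> {i. i < n \<and> Z i \<omega> \<le> t})"
      using u by (intro card_Un_disjoint[symmetric]) (auto simp: Z'_def)
    also have "\<dots> \<le> card {..<n}" by (intro card_mono) auto
    finally have "real (card {i. i < n \<and> Z' i \<omega> \<le> - u}) + real (card {i. i < n \<and> Z i \<omega> \<le> t}) \<le> real n"
      by simp
    then have "ecdf n (\<lambda>i. Z' i \<omega>) (- u) + ecdf n (\<lambda>i. Z i \<omega>) t \<le> 1"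
      using n by (simp add: ecdf_def add_divide_distrib[symmetric])
    with 1 u show ?thesis by (intro exI[of _ "- u"]) simp
  qed
  with cdf_exceeds_ecdf_le[OF n indep' D' l] show thesis
    by (intro that[of "{\<omega> \<in> space M. \<exists>t. l < cdf D' t - ecdf n (\<lambda>i. Z' i \<omega>) t}"]) auto
qed

section \<open>Alien detection\<close>

text \<open>Serves to recover each sample from the joint family indexed by a disjoint sum.\<close>

lemma (in prob_space) indep_vars_reindex:
  assumes g: "inj_on g I" and indep: "indep_vars (\<lambda>_. N) Z (g ` I)"
  shows "indep_vars (\<lambda>_. N) (\<lambda>i. Z (g i)) I"
  unfolding indep_vars_def2
proof (intro conjI ballI)
  show "Z (g i) \<in> measurable M N" if "i \<in> I" for i
    using indep that by (simp add: indep_vars_def2)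
  show "indep_sets (\<lambda>i. {Z (g i) -` A \<inter> space M |A. A \<in> sets N}) I" (is "indep_sets (\<lambda>i. ?F (g i)) I")
    unfolding indep_sets_def
  proof (intro conjI ballI allI impI)
    have F: "indep_sets ?F (g ` I)" using indep by (simp add: indep_vars_def2)
    show "?F (g i) \<subseteq> events" if "i \<in> I" for i
      using F that by (auto simp: indep_sets_def)
    fix J A assume J: "J \<subseteq> I" "J \<noteq> {}" "finite J" and A: "A \<in> (\<Pi> j\<in>J. ?F (g j))"
    define A' where "A' k = A (inv_into I g k)" for k
    have A': "A' (g j) = A j" if "j \<in> J" for j
      using g J that by (auto simp: A'_def inv_into_f_f)
    have "prob (\<Inter>k\<in>g ` J. A' k) = (\<Prod>k\<in>g ` J. prob (A' k))"
    proof (rule indep_setsD[OF F])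
      show "\<forall>k\<in>g ` J. A' k \<in> ?F k" using A A' by (auto simp: Pi_def)
    qed (use J in auto)
    also have "\<dots> = (\<Prod>j\<in>J. prob (A j))"
      using g J A' by (subst prod.reindex) (auto intro: inj_on_subset)
    also have "(\<Inter>k\<in>g ` J. A' k) = (\<Inter>j\<in>J. A j)" using A' by simp
    finally show "prob (\<Inter>j\<in>J. A j) = (\<Prod>j\<in>J. prob (A j))" .
  qed
qed

text \<open>By monotonicity of the CDF, a bound at the maximum is a bound at every admissible score.
  If none is admissible, the threshold is minus infinity and the rate is 1, which suffices since
  \<open>0 \<le> \<eta>\<close>. Success thereby becomes a condition on single sample
  points.\<close>

lemma alien_detection_rate_select_threshold_ge_iff:
  assumes "prob_space D\<^sub>a" and score: "score \<in> borel_measurable D\<^sub>a" and "0 \<le> \<eta>"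
  shows "1 - \<eta> \<le> alien_detection_rate score D\<^sub>a (select_threshold score q \<alpha> n S\<^sub>0 S\<^sub>m) \<longleftrightarrow>
    (\<forall>u\<in>admissible q \<alpha> n (\<lambda>i. score (S\<^sub>0 i)) (\<lambda>i. score (S\<^sub>m i)). score_cdf score D\<^sub>a u \<le> \<eta>)"
proof -
  interpret prob_space D\<^sub>a by fact
  interpret D: real_distribution "distr D\<^sub>a borel score"
    using score by (rule real_distribution_distr)
  define U where "U = admissible q \<alpha> n (\<lambda>i. score (S\<^sub>0 i)) (\<lambda>i. score (S\<^sub>m i))"
  show ?thesis
  proof (cases "U = {}")
    case True
    then show ?thesis
      using \<open>0 \<le> \<eta>\<close> prob_space
      by (simp add: U_def[symmetric] select_threshold_def alien_detection_rate_def)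
  next
    case False
    have fin: "finite U" by (simp add: U_def admissible_def)
    have "alien_detection_rate score D\<^sub>a (select_threshold score q \<alpha> n S\<^sub>0 S\<^sub>m)
        = 1 - score_cdf score D\<^sub>a (Max U)"
      using alien_detection_rate_real[OF \<open>prob_space D\<^sub>a\<close> score] False
      by (simp add: U_def[symmetric] select_threshold_def)
    moreover have "score_cdf score D\<^sub>a u \<le> score_cdf score D\<^sub>a (Max U)" if "u \<in> U" for u
      unfolding score_cdf_def using that fin by (intro D.cdf_nondecreasing) simp
    ultimately show ?thesis
      using Max_in[OF fin False] unfolding U_def[symmetric] by force
  qed
qed

theorem theorem1:
  fixes N :: "'x measure" and D\<^sub>0 D\<^sub>a :: "'x measure" and score :: "'x \<Rightarrow> real"
    and P :: "'w measure" and X Y :: "nat \<Rightarrow> 'w \<Rightarrow> 'x"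
    and \<alpha> q \<epsilon> \<delta> \<eta> :: real and n :: nat
  assumes D0: "prob_space D\<^sub>0" "sets D\<^sub>0 = sets N"
    and Da: "prob_space D\<^sub>a" "sets D\<^sub>a = sets N"
    and score: "score \<in> borel_measurable N"
    and alpha: "0 < \<alpha>" "\<alpha> \<le> 1"
    and q: "0 < q" "q < 1"
    and F0_cont: "continuous_on UNIV (score_cdf score D\<^sub>0)"
    and Fa_cont: "continuous_on UNIV (score_cdf score D\<^sub>a)"
    and P: "prob_space P"
    and indep: "prob_space.indep_vars P (\<lambda>_. N) (case_sum X Y) ({..<n} <+> {..<n})"
    and X_distr: "\<And>i. i < n \<Longrightarrow> distr P N (X i) = D\<^sub>0"
    and Y_distr: "\<And>i. i < n \<Longrightarrow> distr P N (Y i) = mixture \<alpha> D\<^sub>0 D\<^sub>a"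
    and eps: "0 < \<epsilon>" "\<epsilon> < 1 - q"
    and delta: "0 < \<delta>" "\<delta> < 1"
    and n: "real n > 1 / 2 * ln (2 / (1 - sqrt (1 - \<delta>))) * (1 / \<epsilon>)\<^sup>2 * ((2 - \<alpha>) / \<alpha>)\<^sup>2"
    and eta: "\<eta> = q + \<epsilon>"
  shows "measure P {\<omega> \<in> space P.
      alien_detection_rate score D\<^sub>a
        (select_threshold score q \<alpha> n (\<lambda>i. X i \<omega>) (\<lambda>i. Y i \<omega>)) \<ge> 1 - \<eta>} \<ge> 1 - \<delta>"
proof -
  interpret prob_space P by fact
  \<comment> \<open>Chosen so that l + (1 - \<alpha>) l = \<alpha> \<epsilon>: the tolerance for the
    mixture error plus the weighted tolerance for the nominal error.\<close>
  define l where "l = \<epsilon> * \<alpha> / (2 - \<alpha>)"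
  have "\<epsilon> * \<alpha> < 1 * 1" using eps q alpha by (intro mult_less_le_imp_less) auto
  then have l: "0 < l" "l < 1" using eps alpha by (auto simp: l_def divide_simps)
  have small: "2 * exp (- 2 * real n * l\<^sup>2) < 1 - sqrt (1 - \<delta>)" and n0: "0 < n"
  proof -
    define d where "d = 1 - sqrt (1 - \<delta>)"
    have d: "0 < d" "d \<le> 1" using delta by (auto simp: d_def)
    have e: "(1 / \<epsilon>)\<^sup>2 * ((2 - \<alpha>) / \<alpha>)\<^sup>2 = 1 / l\<^sup>2"
      by (simp add: l_def power_divide power_mult_distrib)
    have "1 / 2 * ln (2 / d) * (1 / l\<^sup>2) < real n"
      using n unfolding e[symmetric] d_def by (simp add: mult.assoc)
    then have ln: "ln (2 / d) < 2 * real n * l\<^sup>2"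
      using l by (simp add: field_simps)
    then have "exp (ln (2 / d)) < exp (2 * real n * l\<^sup>2)" by simp
    then have "2 / d < exp (2 * real n * l\<^sup>2)" using d by simp
    then have "2 / exp (2 * real n * l\<^sup>2) < d"
      using d by (simp add: divide_less_eq mult.commute)
    then show "2 * exp (- 2 * real n * l\<^sup>2) < 1 - sqrt (1 - \<delta>)"
      by (simp add: d_def exp_minus divide_inverse)
    \<comment> \<open>Positivity of the logarithm excludes n = 0, where \<open>ecdf\<close> would be
      0 by the convention for division.\<close>
    have "0 < ln (2 / d)" using d by (intro ln_gt_zero) (simp add: less_divide_eq)
    with ln have "0 < 2 * real n * l\<^sup>2" by linarith
    then show "0 < n" by (cases "n = 0") auto
  qed
  have "1 - \<delta> \<le> sqrt (1 - \<delta>)"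
    using delta by (intro real_le_rsqrt) (simp add: power2_eq_square mult_left_le)
  with small have small: "2 * exp (- 2 * real n * l\<^sup>2) \<le> \<delta>" by linarith

  \<comment> \<open>Laws and independence of the scores\<close>
  have score_Da: "score \<in> borel_measurable D\<^sub>a"
    using score by (simp add: measurable_cong_sets[OF Da(2) refl])
  define x where "x = (\<lambda>i \<omega>. score (X i \<omega>))"
  define y where "y = (\<lambda>i \<omega>. score (Y i \<omega>))"
  define F\<^sub>0 where "F\<^sub>0 = score_cdf score D\<^sub>0"
  define F\<^sub>a where "F\<^sub>a = score_cdf score D\<^sub>a"
  define F\<^sub>m where "F\<^sub>m = score_cdf score (mixture \<alpha> D\<^sub>0 D\<^sub>a)"
  have F\<^sub>m: "F\<^sub>m t = (1 - \<alpha>) * F\<^sub>0 t + \<alpha> * F\<^sub>a t" for t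
    unfolding F\<^sub>m_def F\<^sub>0_def F\<^sub>a_def using alpha
    by (intro score_cdf_mixture[OF D0 Da _ _ score]) auto
  have indep_X: "indep_vars (\<lambda>_. N) X {..<n}" and indep_Y: "indep_vars (\<lambda>_. N) Y {..<n}"
  proof -
    have "indep_vars (\<lambda>_. N) (case_sum X Y) (Inl ` {..<n})"
      "indep_vars (\<lambda>_. N) (case_sum X Y) (Inr ` {..<n})"
      by (rule indep_vars_subset[OF indep], force)+
    then show "indep_vars (\<lambda>_. N) X {..<n}" "indep_vars (\<lambda>_. N) Y {..<n}"
      using indep_vars_reindex[of Inl "{..<n}" N "case_sum X Y"]
        indep_vars_reindex[of Inr "{..<n}" N "case_sum X Y"] by simp_all
  qed
  have X: "X i \<in> measurable P N" and Y: "Y i \<in> measurable P N" if "i < n" for i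
    using indep_X indep_Y that by (auto simp: indep_vars_def2)
  have x: "x i \<in> borel_measurable P" and y: "y i \<in> borel_measurable P" if "i < n" for i
    using measurable_compose[OF X[OF that] score] measurable_compose[OF Y[OF that] score]
    by (auto simp: x_def y_def)
  have indep_x: "indep_vars (\<lambda>_. borel) x {..<n}" and indep_y: "indep_vars (\<lambda>_. borel) y {..<n}"
    unfolding x_def y_def
    by (rule indep_vars_compose2[OF indep_X], rule score)
       (rule indep_vars_compose2[OF indep_Y], rule score)
  have x_distr: "distr P borel (x i) = distr D\<^sub>0 borel score" if "i < n" for i
    unfolding X_distr[OF that, symmetric] x_def
    by (subst distr_distr[OF score X[OF that]]) (simp add: comp_def)
  have y_distr: "distr P borel (y i) = distr (mixture \<alpha> D\<^sub>0 D\<^sub>a) borel score" if "i < n" for i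
    unfolding Y_distr[OF that, symmetric] y_def
    by (subst distr_distr[OF score Y[OF that]]) (simp add: comp_def)

  \<comment> \<open>Failure forces a large deviation\<close>
  define dev_m where "dev_m = {\<omega> \<in> space P. \<exists>t. l < F\<^sub>m t - ecdf n (\<lambda>i. y i \<omega>) t}"
  have dev_m: "dev_m \<in> events" "prob dev_m \<le> exp (- 2 * real n * l\<^sup>2)"
    using cdf_exceeds_ecdf_le[OF n0 indep_y y_distr l] by (auto simp: dev_m_def F\<^sub>m_def score_cdf_def)
  obtain dev_0 where dev_0: "dev_0 \<in> events" "prob dev_0 \<le> exp (- 2 * real n * l\<^sup>2)"
    "{\<omega> \<in> space P. \<exists>t. l < ecdf n (\<lambda>i. x i \<omega>) t - F\<^sub>0 t} \<subseteq> dev_0"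
    using ecdf_exceeds_cdf_le[OF n0 indep_x x_distr l] unfolding F\<^sub>0_def score_cdf_def by blast

  \<comment> \<open>A bad point passes the empirical test although its true alien CDF exceeds
    \<eta>; only sample scores are candidates.\<close>
  define bad where "bad \<omega> u \<longleftrightarrow>
      ecdf_alien \<alpha> n (\<lambda>i. x i \<omega>) (\<lambda>i. y i \<omega>) u \<le> q \<and> \<eta> < F\<^sub>a u" for \<omega> u
  define fail where "fail = {\<omega> \<in> space P. \<exists>i<n. bad \<omega> (x i \<omega>) \<or> bad \<omega> (y i \<omega>)}"
  have "fail \<subseteq> dev_m \<union> dev_0"
  proof
    fix \<omega> assume "\<omega> \<in> fail"
    then obtain u where \<omega>: "\<omega> \<in> space P" and u: "bad \<omega> u" by (auto simp: fail_def)
    \<comment> \<open>Subtracting the empirical inequality from the true one, scaled by \<alpha>,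
      gives \<alpha> \<epsilon> < a + (1 - \<alpha>) b. By the choice of \<open>l\<close>, a and b
      cannot both be at most \<open>l\<close>.\<close>
    define a b where "a = F\<^sub>m u - ecdf n (\<lambda>i. y i \<omega>) u" and "b = ecdf n (\<lambda>i. x i \<omega>) u - F\<^sub>0 u"
    have "ecdf n (\<lambda>i. y i \<omega>) u - (1 - \<alpha>) * ecdf n (\<lambda>i. x i \<omega>) u \<le> \<alpha> * q"
      using u alpha by (simp add: bad_def ecdf_alien_def divide_le_eq mult.commute)
    moreover have "\<alpha> * (q + \<epsilon>) < F\<^sub>m u - (1 - \<alpha>) * F\<^sub>0 u"
      using u alpha unfolding F\<^sub>m by (simp add: bad_def eta)
    ultimately have "\<alpha> * \<epsilon> < a + (1 - \<alpha>) * b"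
      by (simp add: a_def b_def algebra_simps)
    moreover have "l + (1 - \<alpha>) * l = \<alpha> * \<epsilon>"
    proof -
      have "l + (1 - \<alpha>) * l = (2 - \<alpha>) * l" by (simp add: algebra_simps)
      then show ?thesis using alpha by (simp add: l_def)
    qed
    moreover have "(1 - \<alpha>) * b \<le> (1 - \<alpha>) * l" if "b \<le> l"
      using that alpha by (intro mult_left_mono) auto
    ultimately have "l < a \<or> l < b" by linarith
    then show "\<omega> \<in> dev_m \<union> dev_0" using \<omega> dev_0(3) by (auto simp: dev_m_def a_def b_def)
  qed
  then have "prob fail \<le> prob (dev_m \<union> dev_0)"
    using dev_m dev_0 by (intro finite_measure_mono) auto
  also have "\<dots> \<le> prob dev_m + prob dev_0" using dev_m dev_0 by (intro measure_Un_le)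
  also have "\<dots> \<le> \<delta>" using dev_m dev_0 small by linarith
  finally have fail_le: "prob fail \<le> \<delta>" .

  \<comment> \<open>Measurability of the failure event\<close>
  have F\<^sub>a_meas: "F\<^sub>a \<in> borel_measurable borel"
    using Fa_cont unfolding F\<^sub>a_def by (rule borel_measurable_continuous_onI)
  \<comment> \<open>Badness is tested at a random score, so the empirical CDFs and the alien CDF are
    composed with \<open>g\<close>; continuity makes the latter Borel measurable.\<close>
  have bad_sets: "{\<omega> \<in> space P. bad \<omega> (g \<omega>)} \<in> events" if g: "g \<in> borel_measurable P" for g
  proof -
    have [measurable]: "(\<lambda>\<omega>. ecdf n (\<lambda>i. x i \<omega>) (g \<omega>)) \<in> borel_measurable P"
      "(\<lambda>\<omega>. ecdf n (\<lambda>i. y i \<omega>) (g \<omega>)) \<in> borel_measurable P"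
      "(\<lambda>\<omega>. F\<^sub>a (g \<omega>)) \<in> borel_measurable P"
      using borel_measurable_ecdf[OF x g] borel_measurable_ecdf[OF y g]
        measurable_compose[OF g F\<^sub>a_meas] by auto
    show ?thesis unfolding bad_def ecdf_alien_def by measurable
  qed
  have "fail = (\<Union>i<n. {\<omega> \<in> space P. bad \<omega> (x i \<omega>)} \<union> {\<omega> \<in> space P. bad \<omega> (y i \<omega>)})"
    by (auto simp: fail_def)
  also have "\<dots> \<in> events"
    using bad_sets[OF x] bad_sets[OF y] by (intro sets.finite_UN sets.Un) auto
  finally have fail_sets: "fail \<in> events" .
  have "{\<omega> \<in> space P. alien_detection_rate score D\<^sub>a
        (select_threshold score q \<alpha> n (\<lambda>i. X i \<omega>) (\<lambda>i. Y i \<omega>)) \<ge> 1 - \<eta>} = space P - fail"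
    using q eps unfolding eta
    by (subst alien_detection_rate_select_threshold_ge_iff[OF Da(1) score_Da])
       (auto simp: fail_def bad_def admissible_def x_def y_def F\<^sub>a_def eta not_less[symmetric])
  then show ?thesis using prob_compl[OF fail_sets] fail_le by simp
qed

end
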